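(* Let $G=(V,E)$ be a finite simple undirected graph. Then \[ k(G) \geq \max_{m \in \{1, \ldots, |V|\}} \; \min_{U \in \binom{V}{m}} \Big( \theta_E(E_G[U]; N_G[U]) - |U| + 1 \Big). \]
   Context: All graphs are finite, simple and undirected. The competition graph $C(D)$ of a digraph $D$ is the graph with vertex set $V(D)$ in which two distinct vertices $x,y$ are adjacent if and only if there is a vertex $v$ with $(x,v),(y,v)$ both arcs of $D$. The competition number $k(G)$ of a graph $G$ is the minimum nonnegative integer $k$ such that $G$ together with $k$ new isolated vertices is the competition graph of some acyclic digraph (a digraph with no directed cycles). A clique of $G$ is a set of vertices inducing a complete subgraph; an edge is covered by a clique if both endpoints lie in it. For $F \subseteq E(G)$, an edge clique cover of $F$ in $G$ is a family of cliques of $G$ such that every edge of $F$ is covered by some clique of the family, and $\theta_E(F;G)$ is the minimum size of such a family. For $U \subseteq V(G)$: $N_G[U]$ is the set $U$ together with all vertices adjacent to some vertex of $U$, and the same symbol denotes the subgraph of $G$ induced by this set; $E_G[U]$ is the set of edges of $G$ having at least one endpoint in $U$. $\binom{V}{m}$ denotes the set of all $m$-element subsets of $V$. *)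

theory Defs
  imports "Graph_Theory.Pair_Digraph"
begin

record 'a ugraph =
  uverts :: "'a set"
  uedges :: "'a set set"

text \<open>Edges are two-element sets of vertices, so loops and multiple edges are excluded.\<close>

definition finite_simple_graph :: "'a ugraph \<Rightarrow> bool" where
  "finite_simple_graph G \<longleftrightarrow>
     finite (uverts G) \<and> (\<forall>e\<in>uedges G. e \<subseteq> uverts G \<and> card e = 2)"

definition competition_graph :: "'a pair_pre_digraph \<Rightarrow> 'a ugraph" where
  "competition_graph D =
     \<lparr> uverts = pverts D,
       uedges = {{x, y} | x y. x \<in> pverts D \<and> y \<in> pverts D \<and> x \<noteq> y \<and>
                   (\<exists>v\<in>pverts D. (x, v) \<in> parcs D \<and> (y, v) \<in> parcs D)} \<rparr>"

text \<open>
  The new vertices are taken from the right summand of a sum type, which makes them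
  distinct from the old ones whatever the type of the vertices of the graph is.
\<close>

definition add_isolated :: "nat \<Rightarrow> 'a ugraph \<Rightarrow> ('a + nat) ugraph" where
  "add_isolated k G =
     \<lparr> uverts = Inl ` uverts G \<union> Inr ` {..<k},
       uedges = (\<lambda>e. Inl ` e) ` uedges G \<rparr>"

text \<open>
  Digraphs are not required to be loop-free here, but \<^const>\<open>acyclic\<close> also excludes loops.
\<close>

definition competition_number :: "'a ugraph \<Rightarrow> nat" where
  "competition_number G =
     (LEAST k. \<exists>D. pair_fin_digraph D \<and> acyclic (parcs D) \<and>
                   competition_graph D = add_isolated k G)"

definition induced_subgraph :: "'a ugraph \<Rightarrow> 'a set \<Rightarrow> 'a ugraph" where
  "induced_subgraph G U =
     \<lparr> uverts = uverts G \<inter> U, uedges = {e \<in> uedges G. e \<subseteq> U} \<rparr>"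

definition complete_graph :: "'a ugraph \<Rightarrow> bool" where
  "complete_graph G \<longleftrightarrow> (\<forall>x\<in>uverts G. \<forall>y\<in>uverts G. x \<noteq> y \<longrightarrow> {x, y} \<in> uedges G)"

definition clique :: "'a ugraph \<Rightarrow> 'a set \<Rightarrow> bool" where
  "clique G C \<longleftrightarrow> C \<subseteq> uverts G \<and> complete_graph (induced_subgraph G C)"

definition edge_clique_cover :: "'a set set \<Rightarrow> 'a ugraph \<Rightarrow> 'a set set \<Rightarrow> bool" where
  "edge_clique_cover F G S \<longleftrightarrow> (\<forall>C\<in>S. clique G C) \<and> (\<forall>e\<in>F. \<exists>C\<in>S. e \<subseteq> C)"

definition theta_E :: "'a set set \<Rightarrow> 'a ugraph \<Rightarrow> nat" where
  "theta_E F G = (LEAST n. \<exists>S. finite S \<and> card S = n \<and> edge_clique_cover F G S)"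

definition closed_nbhd :: "'a ugraph \<Rightarrow> 'a set \<Rightarrow> 'a set" where
  "closed_nbhd G U = U \<union> {v \<in> uverts G. \<exists>u\<in>U. {u, v} \<in> uedges G}"

definition incident_edges :: "'a ugraph \<Rightarrow> 'a set \<Rightarrow> 'a set set" where
  "incident_edges G U = {e \<in> uedges G. e \<inter> U \<noteq> {}}"


text \<open>Both minima are attained, so the uses of \<^const>\<open>Least\<close> above are well defined.\<close>

lemma edge_clique_cover_exists:
  assumes G: "finite_simple_graph G" and F: "F \<subseteq> uedges G"
  shows "\<exists>S. finite S \<and> edge_clique_cover F G S"
proof (intro exI conjI)
  have "uedges G \<subseteq> Pow (uverts G)" "finite (uverts G)"
    using G by (auto simp: finite_simple_graph_def)
  then show "finite F"
    using F by (meson finite_Pow_iff finite_subset)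
  have "clique G e" if "e \<in> F" for e
  proof -
    have e: "e \<in> uedges G" "e \<subseteq> uverts G" "card e = 2"
      using that F G by (auto simp: finite_simple_graph_def)
    obtain x y where "e = {x, y}"
      using e(3) by (auto simp: card_2_iff)
    then have "p = q \<or> {p, q} = e" if "p \<in> e" "q \<in> e" for p q
      using that by blast
    then show ?thesis
      using e by (auto simp: clique_def complete_graph_def induced_subgraph_def)
  qed
  then show "edge_clique_cover F G F"
    by (auto simp: edge_clique_cover_def)
qed

lemma competition_number_exists:
  assumes G: "finite_simple_graph G"
  shows "\<exists>k D. pair_fin_digraph D \<and> acyclic (parcs D) \<and> competition_graph D = add_isolated k G"
proof -
  have sub: "uedges G \<subseteq> Pow (uverts G)" and fin: "finite (uverts G)"
    using G by (auto simp: finite_simple_graph_def)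
  then have finE: "finite (uedges G)"
    by (meson finite_Pow_iff finite_subset)
  define k where "k = card (uedges G)"
  obtain f where f: "bij_betw f (uedges G) {..<k}"
    using ex_bij_betw_finite_nat[OF finE] by (auto simp: k_def lessThan_atLeast0)
  define A :: "(('a + nat) \<times> ('a + nat)) set" where
    "A = {(Inl x, Inr (f e)) | x e. e \<in> uedges G \<and> x \<in> e}"
  define D :: "('a + nat) pair_pre_digraph" where
    "D = \<lparr> pverts = Inl ` uverts G \<union> Inr ` {..<k}, parcs = A \<rparr>"
  have A_sub: "A \<subseteq> pverts D \<times> pverts D"
    using sub f by (auto simp: A_def D_def bij_betw_def)
  have finV: "finite (pverts D)"
    using fin by (simp add: D_def)
  have "finite (parcs D)"
    using A_sub finV finite_subset[OF A_sub] by (simp add: D_def)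
  then have "pair_fin_digraph D"
    using A_sub finV by unfold_locales (auto simp: D_def)
  moreover have "acyclic (parcs D)"
  proof -
    have "\<exists>u v. x = Inl u \<and> y = Inr v" if "(x, y) \<in> A\<^sup>+" for x y
      using that by induction (auto simp: A_def)
    then show ?thesis
      unfolding acyclic_def D_def by fastforce
  qed
  moreover have "competition_graph D = add_isolated k G"
  proof -
    have inj: "e = e'" if "f e = f e'" "e \<in> uedges G" "e' \<in> uedges G" for e e'
      using f that by (auto simp: bij_betw_def inj_on_def)
    have pair: "e = {x, y}" if "e \<in> uedges G" "x \<in> e" "y \<in> e" "x \<noteq> y" for e x y
      using G that by (auto simp: finite_simple_graph_def card_2_iff)
    have "Inl ` e \<in> uedges (competition_graph D)" if e: "e \<in> uedges G" for e
    proof -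
      have "card e = 2"
        using e G by (auto simp: finite_simple_graph_def)
      then obtain x y where xy: "e = {x, y}" "x \<noteq> y"
        by (auto simp: card_2_iff)
      have arcs: "(Inl x, Inr (f e)) \<in> A" "(Inl y, Inr (f e)) \<in> A"
        using e xy by (auto simp: A_def)
      then have "Inl x \<in> pverts D" "Inl y \<in> pverts D" "Inr (f e) \<in> pverts D"
        using A_sub by auto
      moreover have "Inl ` e = {Inl x, Inl y}" "Inl x \<noteq> (Inl y :: 'a + nat)"
        using xy by auto
      moreover have "parcs D = A"
        by (simp add: D_def)
      ultimately show ?thesis
        using arcs unfolding competition_graph_def ugraph.simps mem_Collect_eq by blast
    qed
    moreover have "E \<in> (\<lambda>e. Inl ` e) ` uedges G" if E: "E \<in> uedges (competition_graph D)" for E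
    proof -
      obtain p q v where E: "E = {p, q}" "p \<noteq> q" "(p, v) \<in> A" "(q, v) \<in> A"
        using E by (auto simp: competition_graph_def D_def)
      obtain x e where x: "p = Inl x" "v = Inr (f e)" "e \<in> uedges G" "x \<in> e"
        using E(3) by (auto simp: A_def)
      obtain y e' where y: "q = Inl y" "v = Inr (f e')" "e' \<in> uedges G" "y \<in> e'"
        using E(4) by (auto simp: A_def)
      have "e' = e"
        using x y inj by auto
      then have "e = {x, y}"
        using x y E(2) pair by blast
      then have "E = Inl ` e"
        using x y E(1) by auto
      then show ?thesis
        using x(3) by blast
    qed
    ultimately have "uedges (competition_graph D) = uedges (add_isolated k G)"
      by (auto simp: add_isolated_def)
    then show ?thesis
      by (simp add: competition_graph_def add_isolated_def D_def)
  qed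
  ultimately show ?thesis
    by blast
qed

end

(* In an acyclic digraph whose competition graph is G plus k isolated vertices, let U consist of
   the m vertices of G that come last in a topological order. A common out-neighbour of two
   vertices, one of which is in U, is a new vertex or a member of U other than the first one.
   So the edges meeting U are covered by at most k + m - 1 in-neighbourhoods, and such an
   in-neighbourhood, once it meets U, is a clique inside N[U]. *)

theory Submission
  imports Defs
begin

text \<open>\<open>U\<close> collects the last \<open>m\<close> vertices of a topological order of
  \<open>R\<close> on \<open>V\<close>, and \<open>w\<close> is the vertex just before them. Keeping
  \<open>w\<close> apart records that the m + 1 vertices of \<open>insert w U\<close> have all their
  successors in \<open>V\<close> among only m vertices.\<close>

lemma closed_subset_of_card:
  assumes R: "wf (R\<inverse>)" and V: "finite V" and m: "m < card V"
  shows "\<exists>U w. U \<subseteq> V \<and> card U = m \<and> w \<in> V - U \<and>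
           (\<forall>x\<in>insert w U. \<forall>y\<in>V. (x, y) \<in> R \<longrightarrow> y \<in> U)"
  using m
proof (induction m)
  case 0
  then have "V \<noteq> {}"
    by auto
  then obtain w where "w \<in> V" "\<And>y. (y, w) \<in> R\<inverse> \<Longrightarrow> y \<notin> V"
    using wfE_min'[OF R] by metis
  then have "{} \<subseteq> V \<and> card {} = 0 \<and> w \<in> V - {} \<and>
      (\<forall>x\<in>insert w {}. \<forall>y\<in>V. (x, y) \<in> R \<longrightarrow> y \<in> {})"
    by auto
  then show ?case
    by blast
next
  case (Suc m)
  then obtain U w where U: "U \<subseteq> V" "card U = m" "w \<in> V - U"
    and closed: "\<forall>x\<in>insert w U. \<forall>y\<in>V. (x, y) \<in> R \<longrightarrow> y \<in> U"
    by auto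
  have "finite U"
    using U V finite_subset by blast
  then have card: "card (insert w U) = Suc m"
    using U by simp
  then have "V - insert w U \<noteq> {}"
    using Suc.prems U by (metis Diff_eq_empty_iff \<open>finite U\<close> card_mono finite_insert not_le)
  \<comment> \<open>A minimal element for the converse of \<open>R\<close> is a sink among the
    remaining vertices, so it comes next, going backwards in the order.\<close>
  then obtain z where z: "z \<in> V - insert w U" "\<And>y. (y, z) \<in> R\<inverse> \<Longrightarrow> y \<notin> V - insert w U"
    using wfE_min'[OF R] by metis
  then have "insert w U \<subseteq> V \<and> card (insert w U) = Suc m \<and> z \<in> V - insert w U \<and>
      (\<forall>x\<in>insert z (insert w U). \<forall>y\<in>V. (x, y) \<in> R \<longrightarrow> y \<in> insert w U)"
    using U closed card by auto
  then show ?case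
    by blast
qed

lemma competition_number_attained:
  assumes "finite_simple_graph G"
  obtains D where "pair_fin_digraph D" "acyclic (parcs D)"
    "competition_graph D = add_isolated (competition_number G) G"
  using LeastI_ex[OF competition_number_exists[OF assms]] that
  unfolding competition_number_def by blast

lemma theta_E_le:
  assumes "finite S" "edge_clique_cover F G S"
  shows "theta_E F G \<le> card S"
  unfolding theta_E_def using assms by (intro Least_le) blast

lemma clique_induced_subgraphI:
  assumes "C \<subseteq> uverts G \<inter> W" "\<And>x y. x \<in> C \<Longrightarrow> y \<in> C \<Longrightarrow> x \<noteq> y \<Longrightarrow> {x, y} \<in> uedges G"
  shows "clique (induced_subgraph G W) C"
  using assms by (auto simp: clique_def complete_graph_def induced_subgraph_def)

text \<open>Two vertices with a common out-neighbour compete, so each in-neighbourhood is a clique;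
  an edge with an endpoint in \<open>U\<close> lies in the in-neighbourhood of some vertex of
  \<open>T\<close>.\<close>

lemma theta_E_incident_edges_le:
  fixes D :: "('a + nat) pair_pre_digraph"
  assumes D: "pair_fin_digraph D" and DG: "competition_graph D = add_isolated k G"
    and G: "finite_simple_graph G" and T: "finite T"
    and out: "\<And>u v. u \<in> U \<Longrightarrow> (Inl u, v) \<in> parcs D \<Longrightarrow> v \<in> T"
  shows "theta_E (incident_edges G U) (induced_subgraph G (closed_nbhd G U)) \<le> card T"
proof -
  interpret pair_fin_digraph D
    by (rule D)
  define C where "C v = {x. (Inl x, v) \<in> parcs D}" for v
  \<comment> \<open>An in-neighbourhood that misses \<open>U\<close> may leave
    \<open>closed_nbhd G U\<close>, so it is discarded.\<close>
  define S where "S = C ` {v \<in> T. C v \<inter> U \<noteq> {}}"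
  have verts: "pverts D = Inl ` uverts G \<union> Inr ` {..<k}"
    using DG by (auto simp: competition_graph_def add_isolated_def)
  have edges: "uedges (competition_graph D) = (\<lambda>e. Inl ` e) ` uedges G"
    by (simp add: DG add_isolated_def)
  have C_verts: "C v \<subseteq> uverts G" for v
    using verts by (auto simp: C_def dest: in_arcsD1)
  have C_edge: "{x, y} \<in> uedges G" if "x \<in> C v" "y \<in> C v" "x \<noteq> y" for x y v
  proof -
    have "(Inl x, v) \<in> parcs D" "(Inl y, v) \<in> parcs D" "Inl x \<noteq> (Inl y :: 'a + nat)"
      using that by (auto simp: C_def)
    moreover from this have "Inl x \<in> pverts D" "Inl y \<in> pverts D" "v \<in> pverts D"
      by (auto dest: in_arcsD1 in_arcsD2)
    ultimately have "{Inl x, Inl y} \<in> uedges (competition_graph D)"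
      unfolding competition_graph_def ugraph.simps mem_Collect_eq by blast
    then obtain e where e: "e \<in> uedges G" "Inl ` {x, y} = (Inl ` e :: ('a + nat) set)"
      using edges by auto
    then have "{x, y} = e"
      by (subst (asm) inj_image_eq_iff) auto
    then show ?thesis
      using e by simp
  qed
  have "clique (induced_subgraph G (closed_nbhd G U)) (C v)" if "C v \<inter> U \<noteq> {}" for v
  proof (rule clique_induced_subgraphI)
    show "C v \<subseteq> uverts G \<inter> closed_nbhd G U"
      \<comment> \<open>Any vertex of \<open>C v\<close> is either equal or adjacent to a chosen
        member of \<open>C v\<close> in \<open>U\<close>.\<close>
      using that C_verts[of v] C_edge[of _ v] by (fastforce simp: closed_nbhd_def)
  qed (rule C_edge)
  moreover have "\<exists>K\<in>S. e \<subseteq> K" if e: "e \<in> incident_edges G U" for e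
  proof -
    have eG: "e \<in> uedges G"
      using e by (simp add: incident_edges_def)
    then have "Inl ` e \<in> uedges (competition_graph D)"
      using edges by blast
    then obtain p q v where "Inl ` e = {p, q}" "(p, v) \<in> parcs D" "(q, v) \<in> parcs D"
      by (auto simp: competition_graph_def)
    then have v: "(x, v) \<in> parcs D" if "x \<in> Inl ` e" for x
      using that by auto
    obtain u where "u \<in> e" "u \<in> U"
      using e by (auto simp: incident_edges_def)
    then have "v \<in> T" "C v \<inter> U \<noteq> {}"
      using v out by (auto simp: C_def)
    moreover have "e \<subseteq> C v"
      using v by (auto simp: C_def)
    ultimately show ?thesis
      by (auto simp: S_def)
  qed
  ultimately have "edge_clique_cover (incident_edges G U) (induced_subgraph G (closed_nbhd G U)) S"
    by (auto simp: edge_clique_cover_def S_def)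
  then have "theta_E (incident_edges G U) (induced_subgraph G (closed_nbhd G U)) \<le> card S"
    using T by (intro theta_E_le) (auto simp: S_def)
  \<comment> \<open>Different vertices may have the same in-neighbourhood, which only makes
    \<open>S\<close> smaller.\<close>
  also have "\<dots> \<le> card {v \<in> T. C v \<inter> U \<noteq> {}}"
    unfolding S_def using T by (intro card_image_le) auto
  also have "\<dots> \<le> card T"
    using T by (intro card_mono) auto
  finally show ?thesis .
qed

lemma exists_theta_E_le_competition_number:
  assumes G: "finite_simple_graph G" and m: "m < card (uverts G)"
  shows "\<exists>U. U \<subseteq> uverts G \<and> card U = Suc m \<and>
    theta_E (incident_edges G U) (induced_subgraph G (closed_nbhd G U))
      \<le> competition_number G + m"
proof -
  let ?k = "competition_number G"
  obtain D where D: "pair_fin_digraph D" "acyclic (parcs D)"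
    "competition_graph D = add_isolated ?k G"
    using competition_number_attained[OF G] by blast
  interpret pair_fin_digraph D
    by (rule D)
  have verts: "pverts D = Inl ` uverts G \<union> Inr ` {..<?k}"
    using D(3) by (auto simp: competition_graph_def add_isolated_def)
  have finV: "finite (uverts G)"
    using G by (simp add: finite_simple_graph_def)
  define R where "R = {(x, y). (Inl x, Inl y) \<in> parcs D}"
  have "wf (inv_image ((parcs D)\<inverse>) Inl)"
    using D(2) by (intro wf_inv_image finite_acyclic_wf_converse) auto
  moreover have "inv_image ((parcs D)\<inverse>) Inl = R\<inverse>"
    by (auto simp: R_def inv_image_def)
  ultimately have "wf (R\<inverse>)"
    by simp
  then obtain U w where U: "U \<subseteq> uverts G" "card U = m" "w \<in> uverts G - U"
    and closed: "\<And>x y. x \<in> insert w U \<Longrightarrow> y \<in> uverts G \<Longrightarrow> (x, y) \<in> R \<Longrightarrow> y \<in> U"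
    using closed_subset_of_card[OF _ finV m, of R] by blast
  have finU: "finite U"
    using U finV finite_subset by blast
  let ?T = "Inl ` U \<union> Inr ` {..<?k}"
  \<comment> \<open>A head \<open>v\<close> is a new vertex or an old \<open>R\<close>-successor of
    \<open>u\<close>, and the latter lies in \<open>U\<close> by closedness. So \<open>Inl w\<close>
    is left out of \<open>?T\<close>, which saves one clique and yields the + 1 of the
    bound.\<close>
  have "v \<in> ?T" if "u \<in> insert w U" "(Inl u, v) \<in> parcs D" for u v
    using in_arcsD2[OF that(2)] that closed[of u] verts by (auto simp: R_def)
  then have "theta_E (incident_edges G (insert w U))
      (induced_subgraph G (closed_nbhd G (insert w U))) \<le> card ?T"
    using finU by (intro theta_E_incident_edges_le[OF D(1,3) G]) auto
  also have "card ?T \<le> ?k + m"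
    using finU U by (subst card_Un_disjoint) (auto simp: card_image)
  finally show ?thesis
    using U finU by (intro exI[of _ "insert w U"]) auto
qed

theorem theorem3:
  fixes G :: "'a ugraph"
  assumes "finite_simple_graph G"
    and "uverts G \<noteq> {}"
  shows "int (competition_number G) \<ge>
    (MAX m \<in> {1..card (uverts G)}.
       MIN U \<in> {U. U \<subseteq> uverts G \<and> card U = m}.
         int (theta_E (incident_edges G U) (induced_subgraph G (closed_nbhd G U)))
           - int (card U) + 1)"
proof -
  have fin: "finite (uverts G)"
    using assms by (simp add: finite_simple_graph_def)
  have "(MIN U \<in> {U. U \<subseteq> uverts G \<and> card U = m}.
         int (theta_E (incident_edges G U) (induced_subgraph G (closed_nbhd G U)))
           - int (card U) + 1) \<le> int (competition_number G)"
    if m: "m \<in> {1..card (uverts G)}" for m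
  proof -
    \<comment> \<open>With m = n + 1, the bound k + n on the cover number gives (k + n) - m + 1 =
      k.\<close>
    obtain n where n: "m = Suc n" "n < card (uverts G)"
      using m by (cases m) auto
    obtain U where U: "U \<subseteq> uverts G" "card U = m"
      "theta_E (incident_edges G U) (induced_subgraph G (closed_nbhd G U))
        \<le> competition_number G + n"
      using exists_theta_E_le_competition_number[OF assms(1) n(2)] n by blast
    have "finite {U. U \<subseteq> uverts G \<and> card U = m}"
      using fin by simp
    then show ?thesis
      using U n by (subst Min_le_iff) auto
  qed
  \<comment> \<open>\<open>Max\<close> is meaningful only on a nonempty set, hence the assumption
    that \<open>G\<close> has a vertex.\<close>
  moreover have "{1..card (uverts G)} \<noteq> {}"
    using assms(2) fin by (simp add: Suc_le_eq card_gt_0_iff)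
  ultimately show ?thesis
    by (subst Max_le_iff) auto
qed

end
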